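(* Let $a,b$ be nonzero real numbers and let $j$ be a positive odd integer. Then for every nonzero real $x$, \[ \sqrt[j]{\frac{\psi^{a,b}_{j}\!\left(\frac1a\left(x-\frac bx\right)\right)}{2}+\sqrt{\frac{\left(\psi^{a,b}_{j}\!\left(\frac1a\left(x-\frac bx\right)\right)\right)^2}{4}+b^j}}=\begin{cases} x,& x>0,\ b>0,\\ -\frac bx,& x<0,\ b>0,\\ x,& x\in[-\sqrt{-b},0)\cup[\sqrt{-b},\infty),\ b<0,\\ -\frac bx,& x\in(-\infty,-\sqrt{-b})\cup(0,\sqrt{-b}),\ b<0.\end{cases} \]
   Context: The generalized Lucas polynomials are defined by $\psi^{a,b}_0(x)=2$, $\psi^{a,b}_1(x)=ax$, $\psi^{a,b}_j(x)=ax\,\psi^{a,b}_{j-1}(x)+b\,\psi^{a,b}_{j-2}(x)$ for $j\ge2$. $\sqrt{\cdot}$ is the nonnegative square root, and for odd $j$, $\sqrt[j]{\cdot}$ is the real $j$-th root. *)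

theory Defs
  imports Complex_Main "HOL-Computational_Algebra.Polynomial"
begin

fun gen_lucas :: "real \<Rightarrow> real \<Rightarrow> nat \<Rightarrow> real poly" where
  "gen_lucas a b 0 = [:2:]"
| "gen_lucas a b (Suc 0) = [:0, a:]"
| "gen_lucas a b (Suc (Suc j)) = [:0, a:] * gen_lucas a b (Suc j) + smult b (gen_lucas a b j)"

lemma poly_gen_lucas:
  "poly (gen_lucas a b 0) x = 2"
  "poly (gen_lucas a b 1) x = a * x"
  "j \<ge> 2 \<Longrightarrow> poly (gen_lucas a b j) x =
     a * x * poly (gen_lucas a b (j - 1)) x + b * poly (gen_lucas a b (j - 2)) x"
proof -
  show "j \<ge> 2 \<Longrightarrow> poly (gen_lucas a b j) x =
     a * x * poly (gen_lucas a b (j - 1)) x + b * poly (gen_lucas a b (j - 2)) x"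
    by (cases "(a, b, j)" rule: gen_lucas.cases) (auto simp: algebra_simps)
qed (simp_all)

end

theory Submission
  imports Defs
begin

text \<open>Put \<open>y = - b / x\<close>, so that \<open>x\<close> and \<open>y\<close> are the roots of the characteristic polynomial
  \<open>t\<^sup>2 - (x + y) t - b\<close> of the Lucas recurrence. By Binet's formula \<open>\<psi>\<close> takes the value
  \<open>x^j + y^j\<close>, and for odd \<open>j\<close> the discriminant \<open>\<psi>\<^sup>2 / 4 + b^j\<close> is the square of
  \<open>(x^j - y^j) / 2\<close>. Hence the radicand is \<open>max (x^j) (y^j)\<close>, and its \<open>j\<close>-th root is \<open>max x y\<close>.\<close>

text \<open>Parametrised by the roots, the recurrence reads
  \<open>s (n + 2) = (x + y) * s (n + 1) - x * y * s n\<close>, which both \<open>x ^ n\<close> and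
  \<open>y ^ n\<close> satisfy; a double root needs no separate case.\<close>

lemma poly_gen_lucas_Binet:
  fixes a x y :: real
  assumes "a \<noteq> 0"
  shows "poly (gen_lucas a (- (x * y)) n) ((x + y) / a) = x ^ n + y ^ n"
  using assms
  by (induction a "- (x * y)" n rule: gen_lucas.induct) (simp_all add: field_simps)

text \<open>The midpoint plus half the distance is the larger number.\<close>

lemma half_sum_plus_sqrt_eq_max:
  fixes u v :: real
  shows "(u + v) / 2 + sqrt ((u + v)\<^sup>2 / 4 - u * v) = max u v"
proof -
  have "(u + v)\<^sup>2 / 4 - u * v = ((u - v) / 2)\<^sup>2"
    by (simp add: power2_eq_square field_simps)
  then have "sqrt ((u + v)\<^sup>2 / 4 - u * v) = \<bar>u - v\<bar> / 2"
    by (simp only: real_sqrt_abs abs_divide abs_numeral)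
  then show ?thesis
    by (simp add: max_def abs_if field_simps)
qed

text \<open>An odd power is increasing on all of the reals, so it commutes with \<open>max\<close>,
  and the odd root undoes it for negative bases too.\<close>

lemma root_max_power:
  fixes x y :: real
  assumes "odd n"
  shows "root n (max (x ^ n) (y ^ n)) = max x y"
proof -
  have "mono (\<lambda>x::real. x ^ n)"
    using assms by (intro monoI power_mono_odd)
  then have "max (x ^ n) (y ^ n) = max x y ^ n"
    by (rule max_of_mono)
  then show ?thesis
    using assms by (simp add: odd_real_root_power_cancel)
qed

lemma root_gen_lucas_eq_max:
  fixes a b x :: real
  assumes "a \<noteq> 0" "x \<noteq> 0" "odd j"
  defines "\<psi> \<equiv> poly (gen_lucas a b j) (1 / a * (x - b / x))"
  shows "root j (\<psi> / 2 + sqrt (\<psi>\<^sup>2 / 4 + b ^ j)) = max x (- (b / x))"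
proof -
  define y where "y = - (b / x)"
  have b: "b = - (x * y)"
    using assms by (simp add: y_def)
  have \<psi>: "\<psi> = x ^ j + y ^ j"
    using poly_gen_lucas_Binet[OF \<open>a \<noteq> 0\<close>, of x y j] \<open>x \<noteq> 0\<close> by (simp add: \<psi>_def b)
  \<comment> \<open>Oddness keeps the minus sign of \<open>b = - (x * y)\<close>.\<close>
  have bj: "b ^ j = - (x ^ j * y ^ j)"
    using \<open>odd j\<close> by (simp add: b power_mult_distrib)
  have "\<psi> / 2 + sqrt (\<psi>\<^sup>2 / 4 + b ^ j) = max (x ^ j) (y ^ j)"
    using half_sum_plus_sqrt_eq_max[of "x ^ j" "y ^ j"] by (simp add: \<psi> bj)
  then show ?thesis
    using root_max_power[OF \<open>odd j\<close>] by (simp add: y_def)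
qed

theorem theorem7:
  fixes a b x :: real and j :: nat
  assumes "a \<noteq> 0" and "b \<noteq> 0" and "j > 0" and "odd j" and "x \<noteq> 0"
  shows
    "let \<psi> = poly (gen_lucas a b j) (1 / a * (x - b / x));
         L = root j (\<psi> / 2 + sqrt (\<psi>\<^sup>2 / 4 + b ^ j))
     in (x > 0 \<and> b > 0 \<longrightarrow> L = x) \<and>
        (x < 0 \<and> b > 0 \<longrightarrow> L = - (b / x)) \<and>
        (x \<in> {- sqrt (- b)..<0} \<union> {sqrt (- b)..} \<and> b < 0 \<longrightarrow> L = x) \<and>
        (x \<in> {..<- sqrt (- b)} \<union> {0<..<sqrt (- b)} \<and> b < 0 \<longrightarrow> L = - (b / x))"
proof -
  \<comment> \<open>For \<open>b > 0\<close> the two roots have opposite signs, and the positive one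
    wins.\<close>
  have pos: "max x (- (b / x)) = x" if "x > 0" "b > 0"
  proof -
    have "b / x > 0"
      using that by simp
    then show ?thesis
      using \<open>x > 0\<close> by linarith
  qed
  have neg: "max x (- (b / x)) = - (b / x)" if "x < 0" "b > 0"
  proof -
    have "b / x < 0"
      using that by (simp add: divide_pos_neg)
    then show ?thesis
      using that by simp
  qed
  \<comment> \<open>For \<open>b < 0\<close> the roots share a sign. Multiplying by \<open>x\<close>
    turns their comparison into one of \<open>x\<^sup>2\<close> with \<open>- b\<close>, reversed
    when \<open>x < 0\<close>.\<close>
  have fst_neg: "max x (- (b / x)) = x"
    if b: "b < 0" and x: "x \<in> {- sqrt (- b)..<0} \<union> {sqrt (- b)..}"
  proof (cases "x < 0")
    case True
    \<comment> \<open>This rules out the interval on the positive side.\<close>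
    moreover have "0 < sqrt (- b)"
      using b by simp
    ultimately have "- x \<le> sqrt (- b)"
      using x by (auto simp del: real_sqrt_gt_0_iff)
    then have "(- x)\<^sup>2 \<le> - b"
      using True b by (metis neg_0_le_iff_le less_imp_le power_mono real_sqrt_pow2)
    then show ?thesis
      using True by (intro max_absorb1) (simp add: field_simps power2_eq_square)
  next
    case False
    then have "sqrt (- b) \<le> x" "x > 0"
      using x \<open>x \<noteq> 0\<close> by auto
    then have "- b \<le> x\<^sup>2"
      using sqrt_le_D by blast
    then show ?thesis
      using \<open>x > 0\<close> by (intro max_absorb1) (simp add: field_simps power2_eq_square)
  qed
  have snd_neg: "max x (- (b / x)) = - (b / x)"
    if b: "b < 0" and x: "x \<in> {..<- sqrt (- b)} \<union> {0<..<sqrt (- b)}"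
  proof (cases "x < 0")
    case True
    then have "sqrt (- b) \<le> - x"
      using x by auto
    then have "- b \<le> (- x)\<^sup>2"
      using sqrt_le_D by blast
    then show ?thesis
      using True by (intro max_absorb2) (simp add: field_simps power2_eq_square)
  next
    case False
    moreover have "0 < sqrt (- b)"
      using b by simp
    ultimately have "0 < x" "x \<le> sqrt (- b)"
      using x \<open>x \<noteq> 0\<close> by (auto simp del: real_sqrt_gt_0_iff)
    then have "x\<^sup>2 \<le> - b"
      using b by (metis neg_0_le_iff_le less_imp_le power_mono real_sqrt_pow2)
    then show ?thesis
      using \<open>0 < x\<close> by (intro max_absorb2) (simp add: field_simps power2_eq_square)
  qed
  show ?thesis
    unfolding Let_def root_gen_lucas_eq_max[OF \<open>a \<noteq> 0\<close> \<open>x \<noteq> 0\<close> \<open>odd j\<close>]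
    using pos neg fst_neg snd_neg by blast
qed

end
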